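(* Let $G=(V,w,\mu)$ be a connected finite weighted graph with symmetric edge weights $w$ and vertex measure $\mu\in\mathcal{M}^*(V)$, and let $\deg$ denote its vertex degree. Let $B\subset V$ with $|B|\ge 2$ and $\mu_B=1_B\,\mu\in\mathcal{M}(V)$. Then for any $\nu\in\mathcal{M}(V)$, $$2\,h(\mu_B,\mu_B)\ \ge\ \sigma_2\ \ge\ \frac12\, h(\mu_B,\nu)\, h(\deg,\nu),$$ where $\sigma_2$ is the second smallest eigenvalue (counted with multiplicity) of the Steklov operator $T=T^B$.
   Context: $V$ is a finite set with $|V|\ge 2$. $\mathcal{M}(V)=\{\nu:V\to[0,\infty)\}$ and $\mathcal{M}^*(V)=\{\nu:V\to(0,\infty)\}$; $\nu(A)=\sum_{x\in A}\nu(x)$ for $A\subset V$. $1_B$ is the characteristic function of $B$. A finite weighted graph $G=(V,w,\mu)$ consists of symmetric edge weights $w:V\times V\to[0,\infty)$, $w(x,y)=w(y,x)$, $w(x,x)=0$, and $\mu\in\mathcal{M}^*(V)$; $x,y$ are joined by an edge iff $w(x,y)>0$, and $G$ is connected if this graph is connected. Put $A^c=V\setminus A$, $w(A,A')=\sum_{x\in A,\,y\in A'}w(x,y)$, and $\deg(x)=\sum_{y\ne x}w(x,y)$. The Laplacian is $\Delta f(x)=\frac1{\mu(x)}\sum_{y\in V}w(x,y)(f(x)-f(y))$. Generalized Cheeger constant: for $\mu',\nu\in\mathcal{M}(V)$, $$h(\mu',\nu)=\inf_{\substack{A\subset V:\ \mu'(A)>0,\\ \nu(A)\le\nu(V)/2}}\frac{w(A,A^c)}{\mu'(A)}$$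 (always with the same edge weights $w$). Steklov operator: every $f:B\to\mathbb{C}$ has a unique harmonic extension $F:V\to\mathbb{C}$, i.e. $F=f$ on $B$ and $\Delta F=0$ on $B^c$. The Steklov operator $T=T^B$ acts on functions $B\to\mathbb{C}$ by $Tf(x)=\Delta F(x)$ for $x\in B$. Its eigenvalues are real and non-negative, $0=\sigma_1\le\sigma_2\le\cdots\le\sigma_{|B|}$, counted with multiplicity. *)

theory Defs
  imports "HOL-Analysis.Analysis" "HOL-Library.Function_Algebras"
begin

definition nonneg_on :: "'a set \<Rightarrow> ('a \<Rightarrow> real) \<Rightarrow> bool" where
  "nonneg_on V \<nu> \<longleftrightarrow> (\<forall>x\<in>V. 0 \<le> \<nu> x)"

definition pos_on :: "'a set \<Rightarrow> ('a \<Rightarrow> real) \<Rightarrow> bool" where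
  "pos_on V \<nu> \<longleftrightarrow> (\<forall>x\<in>V. 0 < \<nu> x)"

definition weighted_graph :: "'a set \<Rightarrow> ('a \<Rightarrow> 'a \<Rightarrow> real) \<Rightarrow> ('a \<Rightarrow> real) \<Rightarrow> bool" where
  "weighted_graph V w \<mu> \<longleftrightarrow>
     finite V \<and> 2 \<le> card V \<and>
     (\<forall>x\<in>V. \<forall>y\<in>V. 0 \<le> w x y \<and> w x y = w y x) \<and>
     (\<forall>x\<in>V. w x x = 0) \<and>
     pos_on V \<mu>"

definition edges :: "'a set \<Rightarrow> ('a \<Rightarrow> 'a \<Rightarrow> real) \<Rightarrow> ('a \<times> 'a) set" where
  "edges V w = {(x, y). x \<in> V \<and> y \<in> V \<and> 0 < w x y}"

definition connected_graph :: "'a set \<Rightarrow> ('a \<Rightarrow> 'a \<Rightarrow> real) \<Rightarrow> bool" where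
  "connected_graph V w \<longleftrightarrow> (\<forall>x\<in>V. \<forall>y\<in>V. (x, y) \<in> (edges V w)\<^sup>*)"

definition cut_weight :: "('a \<Rightarrow> 'a \<Rightarrow> real) \<Rightarrow> 'a set \<Rightarrow> 'a set \<Rightarrow> real" where
  "cut_weight w A A' = (\<Sum>x\<in>A. \<Sum>y\<in>A'. w x y)"

definition wdeg :: "'a set \<Rightarrow> ('a \<Rightarrow> 'a \<Rightarrow> real) \<Rightarrow> 'a \<Rightarrow> real" where
  "wdeg V w x = (\<Sum>y\<in>V - {x}. w x y)"

text \<open>The infimum is taken in the reals. The index set is nonempty as soon as \<open>\<mu>'\<close> is
  positive at two points of \<open>V\<close> (one of the two singletons has at most half of the
  \<open>\<nu>\<close>-mass), so the convention for the infimum of the empty set plays no role for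
  \<open>\<mu>' = 1\<^sub>B \<mu>\<close> with at least two points in \<open>B\<close>, nor for the degree of a connected graph.\<close>

definition cheeger ::
  "'a set \<Rightarrow> ('a \<Rightarrow> 'a \<Rightarrow> real) \<Rightarrow> ('a \<Rightarrow> real) \<Rightarrow> ('a \<Rightarrow> real) \<Rightarrow> real" where
  "cheeger V w \<mu>' \<nu> =
     (INF A \<in> {A. A \<subseteq> V \<and> 0 < sum \<mu>' A \<and> sum \<nu> A \<le> sum \<nu> V / 2}.
        cut_weight w A (V - A) / sum \<mu>' A)"

definition laplacian ::
  "'a set \<Rightarrow> ('a \<Rightarrow> 'a \<Rightarrow> real) \<Rightarrow> ('a \<Rightarrow> real) \<Rightarrow> ('a \<Rightarrow> complex) \<Rightarrow> 'a \<Rightarrow> complex" where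
  "laplacian V w \<mu> f x =
     1 / complex_of_real (\<mu> x) * (\<Sum>y\<in>V. complex_of_real (w x y) * (f x - f y))"

text \<open>Functions on a subset \<open>S\<close> are represented by functions on the whole type that
  vanish outside \<open>S\<close>.\<close>

definition functions_on :: "'a set \<Rightarrow> ('a \<Rightarrow> complex) set" where
  "functions_on S = {f. \<forall>x. x \<notin> S \<longrightarrow> f x = 0}"

definition harmonic_extension ::
  "'a set \<Rightarrow> ('a \<Rightarrow> 'a \<Rightarrow> real) \<Rightarrow> ('a \<Rightarrow> real) \<Rightarrow> 'a set \<Rightarrow> ('a \<Rightarrow> complex) \<Rightarrow> 'a \<Rightarrow> complex" where
  "harmonic_extension V w \<mu> B f =
     (THE F. F \<in> functions_on V \<and> (\<forall>x\<in>B. F x = f x) \<and> (\<forall>x\<in>V - B. laplacian V w \<mu> F x = 0))"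

definition steklov ::
  "'a set \<Rightarrow> ('a \<Rightarrow> 'a \<Rightarrow> real) \<Rightarrow> ('a \<Rightarrow> real) \<Rightarrow> 'a set \<Rightarrow> ('a \<Rightarrow> complex) \<Rightarrow> 'a \<Rightarrow> complex" where
  "steklov V w \<mu> B f x =
     (if x \<in> B then laplacian V w \<mu> (harmonic_extension V w \<mu> B f) x else 0)"

definition cscale :: "complex \<Rightarrow> ('a \<Rightarrow> complex) \<Rightarrow> 'a \<Rightarrow> complex" where
  "cscale c f = (\<lambda>x. c * f x)"

global_interpretation cfun: vector_space cscale
  by unfold_locales (auto simp: cscale_def fun_eq_iff algebra_simps)

definition steklov_eigenspace ::
  "'a set \<Rightarrow> ('a \<Rightarrow> 'a \<Rightarrow> real) \<Rightarrow> ('a \<Rightarrow> real) \<Rightarrow> 'a set \<Rightarrow> complex \<Rightarrow> ('a \<Rightarrow> complex) set" where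
  "steklov_eigenspace V w \<mu> B z = {f \<in> functions_on B. steklov V w \<mu> B f = cscale z f}"

definition steklov_spectrum ::
  "'a set \<Rightarrow> ('a \<Rightarrow> 'a \<Rightarrow> real) \<Rightarrow> ('a \<Rightarrow> real) \<Rightarrow> 'a set \<Rightarrow> complex set" where
  "steklov_spectrum V w \<mu> B = {z. \<exists>f \<in> steklov_eigenspace V w \<mu> B z. f \<noteq> 0}"

text \<open>Each eigenvalue is repeated according to the complex dimension of its eigenspace
  (the operator is self-adjoint for the \<open>\<mu>\<close>-weighted inner product on \<open>B\<close>, so
  geometric and algebraic multiplicities agree). The eigenvalues are real, and \<open>Re\<close> only
  serves to sort them.\<close>

definition steklov_eigenvalues ::
  "'a set \<Rightarrow> ('a \<Rightarrow> 'a \<Rightarrow> real) \<Rightarrow> ('a \<Rightarrow> real) \<Rightarrow> 'a set \<Rightarrow> real list" where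
  "steklov_eigenvalues V w \<mu> B =
     sorted_list_of_multiset
       (\<Sum>z\<in>steklov_spectrum V w \<mu> B.
          replicate_mset (cfun.dim (steklov_eigenspace V w \<mu> B z)) (Re z))"

text \<open>Eigenvalues are numbered from 1, list positions from 0.\<close>

definition steklov_sigma ::
  "'a set \<Rightarrow> ('a \<Rightarrow> 'a \<Rightarrow> real) \<Rightarrow> ('a \<Rightarrow> real) \<Rightarrow> 'a set \<Rightarrow> nat \<Rightarrow> real" where
  "steklov_sigma V w \<mu> B k = steklov_eigenvalues V w \<mu> B ! (k - 1)"

end

theory Submission imports Defs begin

text \<open>
  The second Steklov eigenvalue is the spectral gap of the Rayleigh quotient: the Dirichlet energy of
  a function on \<open>V\<close> divided by the variance of its values on \<open>B\<close>. Harmonic extension is the choice of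
  least energy off \<open>B\<close>, so \<open>V\<close>-functions may be used throughout as test functions.

  This is seen from both sides. A minimiser of the Rayleigh quotient exists by compactness, and
  its first variation is the eigenvalue equation (\<open>spectral_gap\<close>). Conversely the operator is
  symmetric, so its eigenvalues are real, and each non-zero one is the Rayleigh quotient of
  a centred function, hence at least the gap (\<open>spectrum_above_gap\<close>). Connectedness makes 0 a simple
  eigenvalue (\<open>zero_simple\<close>). The spectrum is finite and each eigenvalue has positive multiplicity, so
  the sorted list of eigenvalues begins with 0 and then the gap (\<open>sigma_two\<close>).

  For the upper bound, the Rayleigh quotient is tested on the indicators of the sets that compete in
  the Cheeger constant.

  For the lower bound, let \<open>F\<close> be a real eigenfunction, with sign chosen such that \<open>F > 0\<close> on at most
  half of the \<open>\<nu>\<close>-mass, and let \<open>g\<close> be its positive part. Write \<open>M\<close> and \<open>D\<close> for the integrals of \<open>g\<^sup>2\<close>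
  against \<open>\<mu>\<^sub>B\<close> and against the degree. Three facts are combined: the energy of \<open>g\<close> is at most
  \<open>\<sigma>\<^sub>2 M\<close> (\<open>energy_positive_part_le\<close>); the total variation of \<open>g\<^sup>2\<close> is at least \<open>h(\<mu>\<^sub>B,\<nu>) M\<close> and at
  least \<open>h(deg,\<nu>) D\<close> (\<open>coarea\<close>); and by Cauchy-Schwarz its square is at most twice the energy of \<open>g\<close>
  times \<open>D\<close> (\<open>total_variation_square_le\<close>). Hence
  \<open>h(\<mu>\<^sub>B,\<nu>) M \<cdot> h(deg,\<nu>) D \<le> 2 \<sigma>\<^sub>2 M D\<close>.
\<close>

section \<open>Flux and energy\<close>

locale steklov_graph =
  fixes V B :: "'a set" and w :: "'a \<Rightarrow> 'a \<Rightarrow> real" and \<mu> :: "'a \<Rightarrow> real"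
  assumes graph: "weighted_graph V w \<mu>"
    and conn: "connected_graph V w"
    and B_sub: "B \<subseteq> V"
    and card_B: "2 \<le> card B"
begin

lemma fin_V [simp]: "finite V"
  and w_nonneg: "x \<in> V \<Longrightarrow> y \<in> V \<Longrightarrow> 0 \<le> w x y"
  and w_sym: "x \<in> V \<Longrightarrow> y \<in> V \<Longrightarrow> w x y = w y x"
  and w_diag: "x \<in> V \<Longrightarrow> w x x = 0"
  and \<mu>_pos: "x \<in> V \<Longrightarrow> 0 < \<mu> x"
  using graph by (auto simp: weighted_graph_def pos_on_def)

lemma fin_B [simp]: "finite B"
  using B_sub fin_V by (rule finite_subset)

lemma two_in_B: obtains a b where "a \<in> B" "b \<in> B" "a \<noteq> b"
  using card_B by (metis card_le_Suc0_iff_eq fin_B not_less_eq_eq numeral_2_eq_2)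

text \<open>The Laplacian without its normalisation by \<open>\<mu>\<close>. It is kept polymorphic so that the real
  variational arguments and the complex eigenvalue problem share it.\<close>

definition flux :: "('a \<Rightarrow> 'b::real_field) \<Rightarrow> 'a \<Rightarrow> 'b" where
  "flux F x = (\<Sum>y\<in>V. of_real (w x y) * (F x - F y))"

definition energy :: "('a \<Rightarrow> real) \<Rightarrow> real" where
  "energy F = (\<Sum>x\<in>V. \<Sum>y\<in>V. w x y * (F x - F y)\<^sup>2) / 2"

definition mB :: "'a \<Rightarrow> real" where
  "mB x = indicator B x * \<mu> x"

lemma mB_nonneg: "x \<in> V \<Longrightarrow> 0 \<le> mB x"
  and mB_pos: "x \<in> B \<Longrightarrow> 0 < mB x"
  and mB_out: "x \<notin> B \<Longrightarrow> mB x = 0"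
  using B_sub \<mu>_pos by (auto simp: mB_def indicator_def less_imp_le)

lemma sum_mB: "(\<Sum>x\<in>V. of_real (mB x) * g x) = (\<Sum>x\<in>B. of_real (mB x) * (g x :: 'b::real_field))"
  by (rule sum.mono_neutral_right) (use B_sub mB_out in auto)

text \<open>Green's formula: exchanging the two summation variables and averaging.\<close>

lemma green:
  fixes F G :: "'a \<Rightarrow> 'b::real_field"
  shows "(\<Sum>x\<in>V. flux F x * G x) =
    (\<Sum>x\<in>V. \<Sum>y\<in>V. of_real (w x y) * ((F x - F y) * (G x - G y))) / 2"
proof -
  have half: "a = b / 2" if "a + a = b" for a b :: 'b
    using that by (simp add: field_simps flip: mult_2)
  let ?S = "\<Sum>x\<in>V. \<Sum>y\<in>V. of_real (w x y) * ((F x - F y) * G x)"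
  have "?S = (\<Sum>y\<in>V. \<Sum>x\<in>V. of_real (w x y) * ((F x - F y) * G x))"
    by (rule sum.swap)
  also have "\<dots> = (\<Sum>x\<in>V. \<Sum>y\<in>V. of_real (w x y) * ((F y - F x) * G y))"
    by (intro sum.cong refl) (simp add: w_sym)
  finally have "?S + ?S = ?S + (\<Sum>x\<in>V. \<Sum>y\<in>V. of_real (w x y) * ((F y - F x) * G y))"
    by simp
  also have "\<dots> = (\<Sum>x\<in>V. \<Sum>y\<in>V. of_real (w x y) * ((F x - F y) * (G x - G y)))"
    by (simp add: sum.distrib [symmetric] algebra_simps)
  finally have "?S = (\<Sum>x\<in>V. \<Sum>y\<in>V. of_real (w x y) * ((F x - F y) * (G x - G y))) / 2"
    by (rule half)
  then show ?thesis
    by (simp add: flux_def sum_distrib_right mult.assoc)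
qed

lemma green_sym: "(\<Sum>x\<in>V. flux F x * G x) = (\<Sum>x\<in>V. flux G x * (F x :: 'b::real_field))"
  unfolding green [of F G] green [of G F]
  by (intro arg_cong [of _ _ "\<lambda>s. s / 2"] sum.cong refl) (simp only: mult.commute)

lemma energy_eq: "energy F = (\<Sum>x\<in>V. flux F x * F x)"
  by (simp add: green energy_def power2_eq_square)

lemma energy_nonneg: "0 \<le> energy F"
  unfolding energy_def by (intro divide_nonneg_pos sum_nonneg mult_nonneg_nonneg w_nonneg) auto

text \<open>Connectedness is used here: a function that does not vary along edges is constant.\<close>

lemma energy_zero_imp_constant:
  assumes "energy F = 0" "x \<in> V" "y \<in> V"
  shows "F x = F y"
proof -
  have "(\<Sum>x\<in>V. \<Sum>y\<in>V. w x y * (F x - F y)\<^sup>2) = 0"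
    using assms(1) by (simp add: energy_def)
  then have "\<forall>x\<in>V. (\<Sum>y\<in>V. w x y * (F x - F y)\<^sup>2) = 0"
    by (subst (asm) sum_nonneg_eq_0_iff) (auto intro!: sum_nonneg mult_nonneg_nonneg w_nonneg)
  then have row: "(\<Sum>y\<in>V. w x y * (F x - F y)\<^sup>2) = 0" if "x \<in> V" for x
    using that by blast
  have edge: "F x = F y" if e: "(x, y) \<in> edges V w" for x y
  proof -
    have xy: "x \<in> V" "y \<in> V" "0 < w x y" using e by (auto simp: edges_def)
    have "w x y * (F x - F y)\<^sup>2 = 0"
      using row [OF xy(1)] xy(2)
      by (rule sum_nonneg_0 [OF fin_V, rotated]) (simp add: w_nonneg xy(1))
    then show ?thesis using xy(3) by simp
  qed
  have "(x, y) \<in> (edges V w)\<^sup>*"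
    using assms conn by (auto simp: connected_graph_def)
  then show ?thesis
  proof (induction rule: rtrancl_induct)
    case (step y z)
    then show ?case using edge [of y z] by simp
  qed simp
qed

lemma energy_line:
  "energy (\<lambda>x. F x + t * G x) = energy F + 2 * t * (\<Sum>x\<in>V. flux F x * G x) + t\<^sup>2 * energy G"
  unfolding energy_def green by (simp add: sum_distrib_left sum.distrib [symmetric]
      sum_divide_distrib [symmetric] algebra_simps power2_eq_square add_divide_distrib [symmetric])

lemma energy_shift_scale: "energy (\<lambda>x. c * (F x - d)) = c\<^sup>2 * energy F"
proof -
  have "(c * (F x - d) - c * (F y - d))\<^sup>2 = c\<^sup>2 * (F x - F y)\<^sup>2" for x y
    by (simp add: power2_eq_square algebra_simps)
  then show ?thesis
    by (simp add: energy_def sum_distrib_left mult.left_commute)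
qed

lemma sum_delta_V: "x \<in> V \<Longrightarrow> (\<Sum>y\<in>V. f y * (if y = x then 1 else 0)) = (f x :: real)"
  by (simp add: if_distrib [of "\<lambda>z. _ * z"] cong: if_cong)

section \<open>Energy minimisers\<close>

text \<open>Compactness enters only here. A competitor may be arbitrarily large off \<open>B\<close>, but cutting its
  values off at the bound \<open>C\<close> that it satisfies on \<open>B\<close> does not change it on \<open>B\<close> and does not increase
  its energy; so the minimum over a compact box is a global one.\<close>

lemma energy_minimiser:
  fixes P :: "('a \<Rightarrow> real) set"
  assumes closed: "closed P" and ne: "P \<noteq> {}"
    and bound: "\<And>G x. G \<in> P \<Longrightarrow> x \<in> B \<Longrightarrow> \<bar>G x\<bar> \<le> C"
    and local: "\<And>G G'. G \<in> P \<Longrightarrow> (\<And>x. x \<in> B \<Longrightarrow> G' x = G x) \<Longrightarrow> G' \<in> P"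
  obtains F where "F \<in> P" "\<And>x. x \<notin> V \<Longrightarrow> F x = 0" "\<And>G. G \<in> P \<Longrightarrow> energy F \<le> energy G"
proof -
  define box where "box = (\<Pi>\<^sub>E x\<in>UNIV. if x \<in> V then {-C..C} else {0::real})"
  define clip where "clip G x = (if x \<in> V then max (-C) (min C (G x)) else (0::real))" for G x
  have "compactin (product_topology (\<lambda>_. euclidean) (UNIV :: 'a set)) box"
    unfolding box_def by (subst compactin_PiE) auto
  then have "compact box"
    by (simp add: euclidean_product_topology)
  then have cpt: "compact (box \<inter> P)"
    using closed by (rule compact_Int_closed)
  have clip: "clip G \<in> box \<inter> P" "energy (clip G) \<le> energy G" if "G \<in> P" for G
  proof -
    obtain a where "a \<in> B" using two_in_B by blast
    then have "0 \<le> C" using bound [OF that, of a] by linarith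
    then have "clip G \<in> box" by (auto simp: box_def clip_def)
    moreover have "clip G x = G x" if "x \<in> B" for x
      using bound [OF \<open>G \<in> P\<close> that] that B_sub by (auto simp: clip_def)
    ultimately show "clip G \<in> box \<inter> P" using local [OF that] by auto
    have "(clip G x - clip G y)\<^sup>2 \<le> (G x - G y)\<^sup>2" if "x \<in> V" "y \<in> V" for x y
      using that by (intro abs_le_square_iff [THEN iffD1]) (auto simp: clip_def)
    then show "energy (clip G) \<le> energy G"
      unfolding energy_def by (intro divide_right_mono sum_mono mult_left_mono w_nonneg) auto
  qed
  have "continuous_on UNIV energy"
    unfolding energy_def by (intro continuous_intros continuous_on_product_coordinates) auto
  then have cont: "continuous_on (box \<inter> P) energy"
    by (rule continuous_on_subset) simp
  have "box \<inter> P \<noteq> {}" using ne clip(1) by blast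
  from continuous_attains_inf [OF cpt this cont]
  obtain F where F: "F \<in> box \<inter> P" "\<And>G. G \<in> box \<inter> P \<Longrightarrow> energy F \<le> energy G" by blast
  show thesis
  proof (rule that)
    show "F \<in> P" using F by blast
    have "F x \<in> (if x \<in> V then {-C..C} else {0})" for x
      using F(1) unfolding box_def by (intro PiE_mem [of F UNIV]) auto
    then show "F x = 0" if "x \<notin> V" for x using that by (metis singletonD)
    show "energy F \<le> energy G" if "G \<in> P" for G
      using clip [OF that] F(2) [of "clip G"] by linarith
  qed
qed

lemma linear_term_zero:
  fixes a b :: real
  assumes "\<And>t. 0 \<le> 2 * t * a + t\<^sup>2 * b"
  shows "a = 0"
proof (rule ccontr)
  assume "a \<noteq> 0"
  \<comment> \<open>At \<open>t = - a / c\<close> the linear term outweighs the quadratic one, as \<open>c > b\<close>.\<close>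
  define c where "c = \<bar>b\<bar> + 1"
  have c: "0 < c" "b < c" by (auto simp: c_def)
  have "2 * (- a / c) * a + (- a / c)\<^sup>2 * b = (a\<^sup>2 / c) * (b / c - 2)"
    using c by (simp add: field_simps power2_eq_square)
  moreover have "b / c - 2 < 0" using c by (simp add: field_simps)
  moreover have "0 < a\<^sup>2 / c" using \<open>a \<noteq> 0\<close> c by simp
  ultimately have "2 * (- a / c) * a + (- a / c)\<^sup>2 * b < 0"
    by (metis mult_pos_neg)
  with assms show False by (metis not_less)
qed

text \<open>Dirichlet's principle: the extension of least energy is harmonic off \<open>B\<close>.\<close>

lemma dirichlet_exists:
  fixes f :: "'a \<Rightarrow> real"
  obtains F where "\<And>x. x \<notin> V \<Longrightarrow> F x = 0" "\<And>x. x \<in> B \<Longrightarrow> F x = f x"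
    "\<And>x. x \<in> V - B \<Longrightarrow> flux F x = 0"
proof -
  define P where "P = {F. \<forall>x\<in>B. F x = f x}"
  have "P = (\<Inter>x\<in>B. {F. F x = f x})" by (auto simp: P_def)
  then have "closed P"
    by (auto intro!: closed_INT closed_Collect_eq)
  moreover have "P \<noteq> {}" by (auto simp: P_def)
  moreover have "\<bar>G x\<bar> \<le> (\<Sum>x\<in>B. \<bar>f x\<bar>)" if "G \<in> P" "x \<in> B" for G x
    using that member_le_sum [of x B "\<lambda>x. \<bar>f x\<bar>"] by (simp add: P_def)
  moreover have "G' \<in> P" if "G \<in> P" "\<And>x. x \<in> B \<Longrightarrow> G' x = G x" for G G'
    using that by (simp add: P_def)
  ultimately obtain F where F: "F \<in> P" "\<And>x. x \<notin> V \<Longrightarrow> F x = 0"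
    "\<And>G. G \<in> P \<Longrightarrow> energy F \<le> energy G"
    using energy_minimiser [of P "\<Sum>x\<in>B. \<bar>f x\<bar>"] by blast
  show thesis
  proof (rule that)
    show "F x = f x" if "x \<in> B" for x using F(1) that by (simp add: P_def)
    show "flux F x = 0" if x: "x \<in> V - B" for x
    proof (rule linear_term_zero)
      fix t :: real
      let ?d = "\<lambda>y. if y = x then 1 else 0 :: real"
      have "(\<lambda>y. F y + t * ?d y) \<in> P" using F(1) x by (auto simp: P_def)
      then have "energy F \<le> energy (\<lambda>y. F y + t * ?d y)" by (rule F(3))
      also have "\<dots> = energy F + 2 * t * flux F x + t\<^sup>2 * energy ?d"
        unfolding energy_line using x by (simp add: sum_delta_V)
      finally show "0 \<le> 2 * t * flux F x + t\<^sup>2 * energy ?d" by simp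
    qed
  qed (use F in auto)
qed

lemma dirichlet_unique:
  fixes F :: "'a \<Rightarrow> real"
  assumes "\<And>x. x \<in> B \<Longrightarrow> F x = 0" "\<And>x. x \<in> V - B \<Longrightarrow> flux F x = 0" "x \<in> V"
  shows "F x = 0"
proof -
  have "flux F x * F x = 0" if "x \<in> V" for x
    using that assms by (cases "x \<in> B") auto
  then have "energy F = 0" unfolding energy_eq by (intro sum.neutral) blast
  moreover obtain a where "a \<in> B" using two_in_B by blast
  ultimately show ?thesis
    using energy_zero_imp_constant [of F x a] assms B_sub by auto
qed

text \<open>The unnormalised variance on \<open>B\<close> with respect to \<open>\<mu>\<close>: the square of the distance to the
  constants. Using it in place of a side condition of mean zero makes the Rayleigh inequality an
  inequality between two quadratic forms.\<close>

definition variance :: "('a \<Rightarrow> real) \<Rightarrow> real" where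
  "variance G = (\<Sum>x\<in>V. mB x * (G x)\<^sup>2) - (\<Sum>x\<in>V. mB x * G x)\<^sup>2 / sum mB V"

lemma sum_mB_pos: "0 < sum mB V"
proof -
  obtain a where "a \<in> B" using two_in_B by blast
  then show ?thesis
    using B_sub by (intro sum_pos2 [of V a]) (auto simp: mB_pos mB_nonneg)
qed

lemma variance_centred:
  assumes "m = (\<Sum>x\<in>V. mB x * G x) / sum mB V"
  shows "(\<Sum>x\<in>V. mB x * (G x - m)) = 0" "(\<Sum>x\<in>V. mB x * (G x - m)\<^sup>2) = variance G"
proof -
  let ?s = "\<Sum>x\<in>V. mB x * G x"
  have ms: "m * sum mB V = ?s" using assms sum_mB_pos by simp
  show "(\<Sum>x\<in>V. mB x * (G x - m)) = 0"
    by (simp add: right_diff_distrib sum_subtractf sum_distrib_right [symmetric] ms mult.commute [of _ m] sum_distrib_left [symmetric])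
  have "(\<Sum>x\<in>V. mB x * (G x - m)\<^sup>2) = (\<Sum>x\<in>V. mB x * (G x)\<^sup>2 - 2 * m * (mB x * G x) + m\<^sup>2 * mB x)"
    by (intro sum.cong) (auto simp: power2_eq_square algebra_simps)
  also have "\<dots> = (\<Sum>x\<in>V. mB x * (G x)\<^sup>2) - 2 * m * ?s + m\<^sup>2 * sum mB V"
    by (simp add: sum.distrib sum_subtractf sum_distrib_left)
  also have "\<dots> = variance G"
    using assms sum_mB_pos by (simp add: variance_def field_simps power2_eq_square)
  finally show "(\<Sum>x\<in>V. mB x * (G x - m)\<^sup>2) = variance G" .
qed

text \<open>The spectral gap \<open>\<sigma>\<close> is the minimum of the Rayleigh quotient. At a minimiser \<open>F\<close> the form
  \<open>energy - \<sigma> variance\<close> is non-negative and vanishes, so its first variation in the direction of each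
  point mass is zero. This is the eigenvalue equation on \<open>B\<close> together with harmonicity off \<open>B\<close>.\<close>

lemma spectral_gap:
  obtains \<sigma> F where "0 < \<sigma>" "\<forall>x. x \<notin> V \<longrightarrow> F x = 0" "\<forall>x\<in>V. flux F x = \<sigma> * mB x * F x"
    "\<exists>x\<in>B. F x \<noteq> 0" "\<forall>G. \<sigma> * variance G \<le> energy G"
proof -
  define P where "P = {F. (\<Sum>x\<in>V. mB x * F x) = 0 \<and> (\<Sum>x\<in>V. mB x * (F x)\<^sup>2) = 1}"
  \<comment> \<open>Normalisation gives \<open>(G x)\<^sup>2 \<le> 1 / mB x\<close> on \<open>B\<close>; the summand 1 ensures \<open>C \<le> C\<^sup>2\<close>, which
    avoids a square root.\<close>
  define C where "C = 1 + (\<Sum>x\<in>B. 1 / mB x)"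
  have cl: "closed P"
    unfolding P_def by (intro closed_Collect_conj closed_Collect_eq continuous_intros) auto
  have normalised: "(\<lambda>x. (G x - m) / sqrt (variance G)) \<in> P"
    if "m = (\<Sum>x\<in>V. mB x * G x) / sum mB V" "0 < variance G" for G m
    using variance_centred [OF that(1)] that(2)
    by (simp add: P_def power_divide sum_divide_distrib [symmetric])
  have ne: "P \<noteq> {}"
  proof -
    obtain a b where ab: "a \<in> B" "b \<in> B" "a \<noteq> b" by (rule two_in_B)
    \<comment> \<open>A point mass at \<open>a\<close> is not constant on \<open>B\<close>, so its variance is positive.\<close>
    define G where "G = (\<lambda>x. if x = a then 1 else 0 :: real)"
    define m where "m = (\<Sum>x\<in>V. mB x * G x) / sum mB V"
    have "0 < (\<Sum>x\<in>V. mB x * (G x - m)\<^sup>2)"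
    proof (cases "m = 0")
      case True
      then show ?thesis using ab B_sub
        by (intro sum_pos2 [of V a]) (auto simp: mB_pos mB_nonneg G_def)
    next
      case False
      then show ?thesis using ab B_sub
        by (intro sum_pos2 [of V b]) (auto simp: mB_pos mB_nonneg G_def)
    qed
    then have "0 < variance G" using variance_centred [OF m_def] by simp
    then show ?thesis using normalised [OF m_def] by blast
  qed
  have "\<bar>G x\<bar> \<le> C" if "G \<in> P" "x \<in> B" for G x
  proof -
    have xV: "x \<in> V" using that B_sub by auto
    have "mB x * (G x)\<^sup>2 \<le> (\<Sum>x\<in>V. mB x * (G x)\<^sup>2)"
      using member_le_sum [of x V "\<lambda>x. mB x * (G x)\<^sup>2"] xV by (auto simp: mB_nonneg)
    then have "(G x)\<^sup>2 \<le> 1 / mB x"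
      using that mB_pos [of x] by (simp add: P_def field_simps)
    also have "\<dots> \<le> (\<Sum>x\<in>B. 1 / mB x)"
      using member_le_sum [of x B "\<lambda>x. 1 / mB x"] that mB_pos by (auto simp: less_imp_le)
    finally have 1: "(G x)\<^sup>2 \<le> C" by (simp add: C_def)
    have "1 \<le> C" unfolding C_def using mB_pos by (simp add: sum_nonneg less_imp_le)
    then have "C \<le> C\<^sup>2" by (simp add: power2_eq_square)
    with 1 have "\<bar>G x\<bar>\<^sup>2 \<le> C\<^sup>2" by simp
    then show ?thesis using \<open>1 \<le> C\<close> by (auto intro: power2_le_imp_le)
  qed
  moreover have "G' \<in> P" if "G \<in> P" "\<And>x. x \<in> B \<Longrightarrow> G' x = G x" for G G'
  proof -
    have "mB x * g (G' x) = mB x * g (G x)" for x and g :: "real \<Rightarrow> real"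
      using that(2) mB_out by (cases "x \<in> B") auto
    from this [of _ "\<lambda>x. x"] this [of _ "\<lambda>x. x\<^sup>2"] show ?thesis
      using that(1) by (simp only: P_def mem_Collect_eq)
  qed
  ultimately obtain F where F: "F \<in> P" "\<And>x. x \<notin> V \<Longrightarrow> F x = 0"
    "\<And>G. G \<in> P \<Longrightarrow> energy F \<le> energy G"
    using energy_minimiser [OF cl ne, of C] by blast
  have F1: "(\<Sum>x\<in>V. mB x * F x) = 0" "(\<Sum>x\<in>V. mB x * (F x)\<^sup>2) = 1"
    using F(1) by (auto simp: P_def)
  have gap: "energy F * variance G \<le> energy G" for G
  proof (cases "0 < variance G")
    case True
    define m where "m = (\<Sum>x\<in>V. mB x * G x) / sum mB V"
    have "energy F \<le> energy (\<lambda>x. (1 / sqrt (variance G)) * (G x - m))"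
      using F(3) [OF normalised [OF m_def True]] by simp
    also have "\<dots> = energy G / variance G"
      unfolding energy_shift_scale using True by (simp add: power_divide)
    finally show ?thesis using True by (simp add: field_simps)
  next
    case False
    then have "energy F * variance G \<le> 0"
      using energy_nonneg by (simp add: mult_nonneg_nonpos)
    then show ?thesis using energy_nonneg [of G] by linarith
  qed
  have nz: "\<exists>x\<in>B. F x \<noteq> 0"
  proof (rule ccontr)
    assume "\<not> ?thesis"
    then have "mB x * (F x)\<^sup>2 = 0" for x using mB_out by (cases "x \<in> B") auto
    then have "(\<Sum>x\<in>V. mB x * (F x)\<^sup>2) = 0" by (intro sum.neutral) blast
    then show False using F1 by simp
  qed
  show thesis
  proof (rule that; (intro allI ballI impI)?)
    show "0 < energy F"
    proof (rule ccontr)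
      assume "\<not> ?thesis"
      then have "energy F = 0" using energy_nonneg [of F] by simp
      obtain a where a: "a \<in> B" "F a \<noteq> 0" using nz by blast
      have "F x = F a" if "x \<in> V" for x
        using energy_zero_imp_constant [OF \<open>energy F = 0\<close> that] a B_sub by auto
      then have "(\<Sum>x\<in>V. mB x * F x) = sum mB V * F a"
        by (simp add: sum_distrib_right)
      then show False using F1 sum_mB_pos a by simp
    qed
    show "flux F x = energy F * mB x * F x" if x: "x \<in> V" for x
    proof -
      let ?d = "\<lambda>y. if y = x then 1 else 0 :: real"
      define q where "q = (mB x)\<^sup>2 / sum mB V"
      have "flux F x - energy F * (mB x * F x) = 0"
      proof (rule linear_term_zero)
        fix t :: real
        have "(\<Sum>y\<in>V. mB y * (F y + t * ?d y)) = t * mB x"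
          using F1 x by (simp add: distrib_left sum.distrib if_distrib [of "\<lambda>z. _ * z"] cong: if_cong)
        moreover have "(\<Sum>y\<in>V. mB y * (F y + t * ?d y)\<^sup>2) = 1 + 2 * t * (mB x * F x) + t\<^sup>2 * mB x"
        proof -
          have "(\<Sum>y\<in>V. mB y * (F y + t * ?d y)\<^sup>2)
            = (\<Sum>y\<in>V. mB y * (F y)\<^sup>2 + (2 * t * (mB y * F y) + t\<^sup>2 * mB y) * ?d y)"
            by (intro sum.cong) (auto simp: power2_eq_square algebra_simps)
          also have "\<dots> = 1 + (2 * t * (mB x * F x) + t\<^sup>2 * mB x)"
            unfolding sum.distrib using F1 sum_delta_V [OF x] by simp
          finally show ?thesis by simp
        qed
        ultimately have v: "variance (\<lambda>y. F y + t * ?d y)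
            = 1 + 2 * t * (mB x * F x) + t\<^sup>2 * mB x - t\<^sup>2 * q"
          by (simp add: variance_def q_def power_mult_distrib)
        have e: "energy (\<lambda>y. F y + t * ?d y) = energy F + 2 * t * flux F x + t\<^sup>2 * energy ?d"
          unfolding energy_line using x by (simp add: sum_delta_V)
        show "0 \<le> 2 * t * (flux F x - energy F * (mB x * F x))
            + t\<^sup>2 * (energy ?d - energy F * (mB x - q))"
          using gap [of "\<lambda>y. F y + t * ?d y"] unfolding v e by (simp add: algebra_simps)
      qed
      then show ?thesis by simp
    qed
  qed (use F(2) nz gap in blast)+
qed

section \<open>The Steklov operator\<close>

lemma laplacian_eq: "laplacian V w \<mu> F x = flux F x / of_real (\<mu> x)"
  by (simp add: laplacian_def flux_def)

lemma flux_Re: "Re (flux F x) = flux (\<lambda>y. Re (F y)) x"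
  and flux_Im: "Im (flux F x) = flux (\<lambda>y. Im (F y)) x"
  by (simp_all add: flux_def)

lemma flux_of_real: "flux (\<lambda>y. complex_of_real (F y)) x = of_real (flux F x)"
  by (simp add: flux_def)

lemma flux_cnj: "flux (\<lambda>y. cnj (F y)) x = cnj (flux F x)"
  by (simp add: flux_def)

lemma flux_diff: "flux (\<lambda>y. F y - G y) x = flux F x - flux (G::'a \<Rightarrow> 'b::real_field) x"
  by (simp add: flux_def sum_subtractf [symmetric] algebra_simps)

text \<open>Uniqueness and existence in the complex Dirichlet problem are reduced to the real one through
  real and imaginary parts; together they give the definite description in the definition of the
  harmonic extension its meaning.\<close>

abbreviation ext :: "('a \<Rightarrow> complex) \<Rightarrow> 'a \<Rightarrow> complex" where
  "ext \<equiv> harmonic_extension V w \<mu> B"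

definition is_ext :: "('a \<Rightarrow> complex) \<Rightarrow> ('a \<Rightarrow> complex) \<Rightarrow> bool" where
  "is_ext f F \<longleftrightarrow> F \<in> functions_on V \<and> (\<forall>x\<in>B. F x = f x) \<and> (\<forall>x\<in>V - B. flux F x = 0)"

lemma is_ext_unique:
  assumes "is_ext f F" "is_ext f G"
  shows "F = G"
proof
  fix x
  show "F x = G x"
  proof (cases "x \<in> V")
    case True
    let ?D = "\<lambda>y. F y - G y"
    have 1: "?D y = 0" if "y \<in> B" for y using assms that by (simp add: is_ext_def)
    have 2: "flux ?D y = 0" if "y \<in> V - B" for y
      using assms that unfolding flux_diff by (simp add: is_ext_def)
    have "Re (?D x) = 0"
      by (rule dirichlet_unique [OF _ _ True]) (use 1 2 in \<open>auto simp flip: flux_Re simp del: minus_complex.simps\<close>)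
    moreover have "Im (?D x) = 0"
      by (rule dirichlet_unique [OF _ _ True]) (use 1 2 in \<open>auto simp flip: flux_Im simp del: minus_complex.simps\<close>)
    ultimately show ?thesis by (simp add: complex_eq_iff)
  qed (use assms in \<open>auto simp: is_ext_def functions_on_def\<close>)
qed

lemma ext_eqI: "is_ext f F \<Longrightarrow> ext f = F"
proof -
  assume F: "is_ext f F"
  have "(\<forall>x\<in>V - B. laplacian V w \<mu> F x = 0) \<longleftrightarrow> (\<forall>x\<in>V - B. flux F x = 0)" for F
    using \<mu>_pos by (force simp: laplacian_eq)
  then have "ext f = (THE F. is_ext f F)"
    by (simp add: harmonic_extension_def is_ext_def)
  also have "\<dots> = F"
    using F is_ext_unique by blast
  finally show ?thesis .
qed

lemma is_ext: "is_ext f (ext f)"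
proof -
  obtain R where R: "\<And>x. x \<notin> V \<Longrightarrow> R x = 0" "\<And>x. x \<in> B \<Longrightarrow> R x = Re (f x)"
    "\<And>x. x \<in> V - B \<Longrightarrow> flux R x = 0"
    using dirichlet_exists [of "\<lambda>x. Re (f x)"] by blast
  obtain I where I: "\<And>x. x \<notin> V \<Longrightarrow> I x = 0" "\<And>x. x \<in> B \<Longrightarrow> I x = Im (f x)"
    "\<And>x. x \<in> V - B \<Longrightarrow> flux I x = 0"
    using dirichlet_exists [of "\<lambda>x. Im (f x)"] by blast
  have "is_ext f (\<lambda>x. Complex (R x) (I x))"
    using R I by (auto simp: is_ext_def functions_on_def complex_eq_iff flux_Re flux_Im)
  then show ?thesis using ext_eqI by metis
qed

abbreviation eigenspace :: "complex \<Rightarrow> ('a \<Rightarrow> complex) set" where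
  "eigenspace \<equiv> steklov_eigenspace V w \<mu> B"

text \<open>The eigenvalue equation on \<open>B\<close> and harmonicity off \<open>B\<close> combine into one equation on all of \<open>V\<close>,
  because \<open>mB\<close> vanishes off \<open>B\<close>.\<close>

lemma eigenspace_iff:
  "f \<in> eigenspace z \<longleftrightarrow>
    f \<in> functions_on B \<and> (\<forall>x\<in>V. flux (ext f) x = z * of_real (mB x) * ext f x)"
proof -
  note E = is_ext [of f, unfolded is_ext_def]
  have "steklov V w \<mu> B f x = cscale z f x \<longleftrightarrow> flux (ext f) x = z * of_real (mB x) * ext f x"
    if "x \<in> B" for x
    using that E \<mu>_pos [of x] B_sub
    by (auto simp: steklov_def cscale_def laplacian_eq mB_def field_simps)
  moreover have "flux (ext f) x = z * of_real (mB x) * ext f x" if "x \<in> V - B" for x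
    using that E mB_out by auto
  moreover have "steklov V w \<mu> B f x = cscale z f x" if "x \<notin> B" "f \<in> functions_on B" for x
    using that by (auto simp: steklov_def cscale_def functions_on_def)
  ultimately show ?thesis
    using B_sub unfolding steklov_eigenspace_def fun_eq_iff by blast
qed

lemma restrict_in_eigenspace:
  assumes F: "\<And>x. x \<notin> V \<Longrightarrow> F x = 0" and eq: "\<And>x. x \<in> V \<Longrightarrow> flux F x = z * of_real (mB x) * F x"
  shows "(\<lambda>x. if x \<in> B then F x else 0) \<in> eigenspace z"
proof -
  let ?f = "\<lambda>x. if x \<in> B then F x else 0"
  have "is_ext ?f F"
    using F eq by (auto simp: is_ext_def functions_on_def mB_out)
  then have "ext ?f = F" by (rule ext_eqI)
  then show ?thesis
    using eq by (auto simp: eigenspace_iff functions_on_def)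
qed

definition inner_B :: "('a \<Rightarrow> complex) \<Rightarrow> ('a \<Rightarrow> complex) \<Rightarrow> complex" where
  "inner_B f g = (\<Sum>x\<in>B. of_real (mB x) * (f x * cnj (g x)))"

lemma inner_B_self_nonzero:
  assumes "f \<in> functions_on B" "f \<noteq> 0"
  shows "inner_B f f \<noteq> 0"
proof -
  obtain a where a: "f a \<noteq> 0" using assms(2) by (auto simp: fun_eq_iff)
  then have "a \<in> B" using assms(1) by (auto simp: functions_on_def)
  have "inner_B f f = of_real (\<Sum>x\<in>B. mB x * (cmod (f x))\<^sup>2)"
    unfolding inner_B_def of_real_sum of_real_mult by (simp only: complex_norm_square)
  moreover have "0 < (\<Sum>x\<in>B. mB x * (cmod (f x))\<^sup>2)"
    using a \<open>a \<in> B\<close> mB_pos by (intro sum_pos2 [of B a]) (auto simp: less_imp_le)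
  ultimately show ?thesis by (metis less_irrefl of_real_eq_0_iff)
qed

text \<open>Green's formula makes the operator self-adjoint. With \<open>f = g\<close> this shows that the eigenvalues are
  real, and for different eigenvalues it shows orthogonality.\<close>

lemma eigenfunctions_inner:
  assumes "f \<in> eigenspace z" "g \<in> eigenspace u"
  shows "(z - cnj u) * inner_B f g = 0"
proof -
  have i: "(\<Sum>x\<in>V. of_real (mB x) * (ext f x * cnj (ext g x))) = inner_B f g"
    unfolding sum_mB inner_B_def
    using is_ext [of f] is_ext [of g] by (intro sum.cong) (auto simp: is_ext_def)
  have "z * inner_B f g = (\<Sum>x\<in>V. flux (ext f) x * cnj (ext g x))"
    unfolding i [symmetric] sum_distrib_left
    using assms(1) by (intro sum.cong) (auto simp: eigenspace_iff)
  also have "\<dots> = (\<Sum>x\<in>V. cnj (flux (ext g) x) * ext f x)"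
    using green_sym [of "ext f" "\<lambda>x. cnj (ext g x)"] by (simp add: flux_cnj)
  also have "\<dots> = cnj u * inner_B f g"
    unfolding i [symmetric] sum_distrib_left
    using assms(2) by (intro sum.cong) (auto simp: eigenspace_iff)
  finally show ?thesis by (simp add: algebra_simps)
qed

abbreviation spectrum :: "complex set" where
  "spectrum \<equiv> steklov_spectrum V w \<mu> B"

lemma spectrum_real: "z \<in> spectrum \<Longrightarrow> z = of_real (Re z)"
proof -
  assume "z \<in> spectrum"
  then obtain f where f: "f \<in> eigenspace z" "f \<noteq> 0" by (auto simp: steklov_spectrum_def)
  then have "inner_B f f \<noteq> 0" by (intro inner_B_self_nonzero) (auto simp: eigenspace_iff)
  then have "z = cnj z" using eigenfunctions_inner [OF f(1) f(1)] by simp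
  then show ?thesis by (simp add: complex_eq_iff)
qed

text \<open>Since the eigenvalue is real, the real and imaginary parts of the harmonic extension solve the
  eigenvalue equation separately.\<close>

lemma real_eigenfunction:
  assumes "z \<in> spectrum"
  obtains R :: "'a \<Rightarrow> real" where "\<And>x. x \<in> V \<Longrightarrow> flux R x = Re z * mB x * R x" "\<exists>x\<in>B. R x \<noteq> 0"
proof -
  obtain f where f: "f \<in> eigenspace z" "f \<noteq> 0"
    using assms by (auto simp: steklov_spectrum_def)
  obtain a where a: "f a \<noteq> 0" using f(2) by (auto simp: fun_eq_iff)
  then have "a \<in> B" using f(1) by (auto simp: eigenspace_iff functions_on_def)
  then have "ext f a \<noteq> 0" using a is_ext [of f] by (simp add: is_ext_def)
  have "Im z = 0" using spectrum_real [OF assms] by (metis Im_complex_of_real)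
  have "flux (\<lambda>x. Re (ext f x)) x = Re z * mB x * Re (ext f x)"
       "flux (\<lambda>x. Im (ext f x)) x = Re z * mB x * Im (ext f x)" if "x \<in> V" for x
    using f(1) that \<open>Im z = 0\<close> by (simp_all add: eigenspace_iff flip: flux_Re flux_Im)
  moreover have "Re (ext f a) \<noteq> 0 \<or> Im (ext f a) \<noteq> 0"
    using \<open>ext f a \<noteq> 0\<close> by (simp add: complex_eq_iff)
  ultimately show thesis
    using that [of "\<lambda>x. Re (ext f x)"] that [of "\<lambda>x. Im (ext f x)"] \<open>a \<in> B\<close> by blast
qed

lemma sum_flux: "(\<Sum>x\<in>V. flux F x) = (0::real)"
proof -
  have "(\<Sum>x\<in>V. flux F x * 1) = 0" by (subst green) simp
  then show ?thesis by simp
qed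

lemma real_eigenfunction_energy:
  fixes R :: "'a \<Rightarrow> real"
  assumes "\<And>x. x \<in> V \<Longrightarrow> flux R x = r * mB x * R x"
  shows "energy R = r * (\<Sum>x\<in>V. mB x * (R x)\<^sup>2)" and "r * (\<Sum>x\<in>V. mB x * R x) = 0"
proof -
  show "energy R = r * (\<Sum>x\<in>V. mB x * (R x)\<^sup>2)"
    unfolding energy_eq sum_distrib_left using assms
    by (intro sum.cong) (auto simp: power2_eq_square)
  have "r * (\<Sum>x\<in>V. mB x * R x) = (\<Sum>x\<in>V. flux R x)"
    unfolding sum_distrib_left using assms by (intro sum.cong) auto
  then show "r * (\<Sum>x\<in>V. mB x * R x) = 0" by (simp add: sum_flux)
qed

lemma sum_mB_square_pos:
  fixes R :: "'a \<Rightarrow> real"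
  assumes "a \<in> B" "R a \<noteq> 0"
  shows "0 < (\<Sum>x\<in>V. mB x * (R x)\<^sup>2)"
  using assms B_sub by (intro sum_pos2 [of V a]) (auto simp: mB_pos mB_nonneg)

text \<open>Non-zero eigenvalues are Rayleigh quotients of centred functions,
  because the total flux is zero.\<close>

lemma spectrum_above_gap:
  assumes gap: "\<And>G. \<sigma> * variance G \<le> energy G" and z: "z \<in> spectrum" "z \<noteq> 0"
  shows "\<sigma> \<le> Re z"
proof -
  obtain R where R: "\<And>x. x \<in> V \<Longrightarrow> flux R x = Re z * mB x * R x" "\<exists>x\<in>B. R x \<noteq> 0"
    using real_eigenfunction [OF z(1)] by blast
  have "Re z \<noteq> 0" using spectrum_real [OF z(1)] z(2) by auto
  then have "(\<Sum>x\<in>V. mB x * R x) = 0" using real_eigenfunction_energy(2) [OF R(1)] by simp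
  then have "variance R = (\<Sum>x\<in>V. mB x * (R x)\<^sup>2)" by (simp add: variance_def)
  moreover have "0 < (\<Sum>x\<in>V. mB x * (R x)\<^sup>2)" using R(2) sum_mB_square_pos by blast
  ultimately show ?thesis
    using gap [of R] real_eigenfunction_energy(1) [OF R(1)] by simp
qed

section \<open>Multiplicities and the second eigenvalue\<close>

lemma sum_fun_apply: "(\<Sum>v\<in>T. g v) x = (\<Sum>v\<in>T. g v x)"
  for g :: "'c \<Rightarrow> 'a \<Rightarrow> complex"
  by (induction T rule: infinite_finite_induct) auto

abbreviation point_masses :: "('a \<Rightarrow> complex) set" where
  "point_masses \<equiv> (\<lambda>b x. if x = b then 1 else 0) ` B"

lemma functions_on_B_span: "functions_on B \<subseteq> cfun.span point_masses"
proof
  fix f assume f: "f \<in> functions_on B"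
  have "f = (\<Sum>b\<in>B. cscale (f b) (\<lambda>x. if x = b then 1 else 0))"
  proof
    fix x show "f x = (\<Sum>b\<in>B. cscale (f b) (\<lambda>x. if x = b then 1 else 0)) x"
      using f by (auto simp: sum_fun_apply cscale_def functions_on_def if_distrib [of "\<lambda>z. _ * z"]
          cong: if_cong)
  qed
  moreover have "\<dots> \<in> cfun.span point_masses"
    by (intro cfun.span_sum cfun.span_scale cfun.span_base) auto
  ultimately show "f \<in> cfun.span point_masses" by simp
qed

lemma independent_in_functions_on_B_finite:
  assumes "cfun.independent S" "S \<subseteq> functions_on B"
  shows "finite S"
  using cfun.independent_span_bound [of point_masses S] assms functions_on_B_span by auto

text \<open>Eigenfunctions for different eigenvalues are orthogonal, hence independent in the
  finite-dimensional space of functions on \<open>B\<close>.\<close>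

lemma finite_spectrum: "finite spectrum"
proof -
  define \<phi> where "\<phi> z = (SOME f. f \<in> eigenspace z \<and> f \<noteq> 0)" for z
  have \<phi>: "\<phi> z \<in> eigenspace z" "\<phi> z \<noteq> 0" "inner_B (\<phi> z) (\<phi> z) \<noteq> 0" if z: "z \<in> spectrum" for z
  proof -
    have "\<exists>f. f \<in> eigenspace z \<and> f \<noteq> 0" using z by (auto simp: steklov_spectrum_def)
    then have 1: "\<phi> z \<in> eigenspace z \<and> \<phi> z \<noteq> 0" unfolding \<phi>_def by (rule someI_ex)
    then show "\<phi> z \<in> eigenspace z" "\<phi> z \<noteq> 0" by auto
    then show "inner_B (\<phi> z) (\<phi> z) \<noteq> 0"
      by (intro inner_B_self_nonzero) (auto simp: eigenspace_iff)
  qed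
  have orth: "inner_B (\<phi> z) (\<phi> u) = 0" if "z \<in> spectrum" "u \<in> spectrum" "z \<noteq> u" for z u
  proof -
    have "cnj u = u" using spectrum_real [OF that(2)] by (metis complex_cnj_complex_of_real)
    then show ?thesis using eigenfunctions_inner [OF \<phi>(1) \<phi>(1)] that by force
  qed
  have inj: "inj_on \<phi> spectrum"
    by (rule inj_onI) (metis \<phi>(3) orth)
  have "cfun.independent (\<phi> ` spectrum)"
    unfolding cfun.independent_explicit_module
  proof (intro allI impI)
    fix T c v
    assume T: "finite T" "T \<subseteq> \<phi> ` spectrum" "(\<Sum>v\<in>T. cscale (c v) v) = 0" "v \<in> T"
    have "0 = inner_B (\<Sum>u\<in>T. cscale (c u) u) v" by (simp add: T(3) inner_B_def)
    also have "\<dots> = (\<Sum>x\<in>B. \<Sum>u\<in>T. c u * (of_real (mB x) * (u x * cnj (v x))))"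
      by (simp add: inner_B_def sum_fun_apply cscale_def sum_distrib_left sum_distrib_right
          mult.left_commute mult.assoc)
    also have "\<dots> = (\<Sum>u\<in>T. c u * inner_B u v)"
      by (subst sum.swap) (simp add: inner_B_def sum_distrib_left)
    also have "\<dots> = (\<Sum>u\<in>{v}. c u * inner_B u v)"
    proof (rule sum.mono_neutral_right)
      show "\<forall>u\<in>T - {v}. c u * inner_B u v = 0"
        using T(2,4) orth by (auto simp: subset_iff image_iff) metis
    qed (use T in auto)
    finally have "c v * inner_B v v = 0" by simp
    moreover have "inner_B v v \<noteq> 0" using T(2,4) \<phi>(3) by auto
    ultimately show "c v = 0" by simp
  qed
  moreover have "\<phi> ` spectrum \<subseteq> functions_on B"
    using \<phi>(1) by (auto simp: eigenspace_iff)
  ultimately have "finite (\<phi> ` spectrum)"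
    by (rule independent_in_functions_on_B_finite)
  then show ?thesis using inj by (rule finite_imageD)
qed

lemma eigenspace_dim_pos:
  assumes "z \<in> spectrum"
  shows "0 < cfun.dim (eigenspace z)"
proof -
  obtain S where S: "S \<subseteq> eigenspace z" "cfun.independent S" "eigenspace z \<subseteq> cfun.span S"
    "card S = cfun.dim (eigenspace z)"
    by (rule cfun.basis_exists)
  have "S \<subseteq> functions_on B" using S(1) by (auto simp: eigenspace_iff)
  then have "finite S" using S(2) by (intro independent_in_functions_on_B_finite)
  moreover have "S \<noteq> {}"
    using S(3) assms by (auto simp: steklov_spectrum_def)
  ultimately show ?thesis using S(4) by (metis card_gt_0_iff)
qed

text \<open>The extension of an eigenfunction for 0 is harmonic on all of \<open>V\<close>, hence has energy zero and is
  constant.\<close>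

lemma zero_simple: "0 \<in> spectrum" "cfun.dim (eigenspace 0) = 1"
proof -
  define e where "e = (\<lambda>x. if x \<in> B then 1 else 0 :: complex)"
  obtain a where a: "a \<in> B" using two_in_B by blast
  then have e0: "e \<noteq> 0" by (auto simp: e_def fun_eq_iff)
  have "(\<lambda>x. if x \<in> B then (if x \<in> V then 1 else 0) else 0) \<in> eigenspace 0"
    by (rule restrict_in_eigenspace) (auto simp: flux_def)
  also have "(\<lambda>x. if x \<in> B then (if x \<in> V then 1 else 0) else 0) = e"
    using B_sub by (auto simp: e_def fun_eq_iff)
  finally have e: "e \<in> eigenspace 0" .
  then show "0 \<in> spectrum" using e0 by (auto simp: steklov_spectrum_def)
  have "f \<in> cfun.span {e}" if f: "f \<in> eigenspace 0" for f
  proof -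
    have fl: "flux (ext f) x = 0" if "x \<in> V" for x
      using f that by (simp add: eigenspace_iff)
    have "energy (\<lambda>x. Re (ext f x)) = 0" "energy (\<lambda>x. Im (ext f x)) = 0"
      by (simp_all add: energy_eq fl flip: flux_Re flux_Im)
    then have const: "ext f x = ext f a" if "x \<in> V" for x
      using energy_zero_imp_constant that a B_sub by (auto simp: complex_eq_iff)
    have "f x = cscale (f a) e x" for x
      using const [of x] is_ext [of f] a f B_sub
      by (cases "x \<in> B") (auto simp: e_def cscale_def is_ext_def eigenspace_iff functions_on_def)
    then have "f = cscale (f a) e" by blast
    then show ?thesis by (metis cfun.span_base cfun.span_scale singletonI)
  qed
  then show "cfun.dim (eigenspace 0) = 1"
    using e e0 by (intro cfun.dim_unique [of "{e}"]) auto
qed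

text \<open>Zero is simple and every other eigenvalue is at least the spectral gap, which is itself an
  eigenvalue; so the gap stands second in the sorted list.\<close>

theorem sigma_two:
  obtains F where "0 < steklov_sigma V w \<mu> B 2"
    "\<forall>x\<in>V. flux F x = steklov_sigma V w \<mu> B 2 * mB x * F x" "\<exists>x\<in>B. F x \<noteq> 0"
    "\<forall>G. steklov_sigma V w \<mu> B 2 * variance G \<le> energy G"
proof -
  obtain \<sigma> F where gap: "0 < \<sigma>" "\<forall>x. x \<notin> V \<longrightarrow> F x = 0"
    "\<forall>x\<in>V. flux F x = \<sigma> * mB x * F x" "\<exists>x\<in>B. F x \<noteq> 0" "\<forall>G. \<sigma> * variance G \<le> energy G"
    by (rule spectral_gap)
  note F = gap(1) gap(2) [rule_format] gap(3) [rule_format] gap(4) gap(5) [rule_format]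
  let ?f = "\<lambda>x. if x \<in> B then complex_of_real (F x) else 0"
  have f: "?f \<in> eigenspace (of_real \<sigma>)"
    using F(2,3) by (intro restrict_in_eigenspace) (simp_all add: flux_of_real)
  obtain a where a: "a \<in> B" "F a \<noteq> 0" using F(4) by blast
  then have "?f a \<noteq> 0" by simp
  then have "?f \<noteq> 0" by (intro notI) (drule fun_cong [of _ _ a], simp)
  with f have \<sigma>_spec: "of_real \<sigma> \<in> spectrum"
    unfolding steklov_spectrum_def by blast
  let ?d = "\<lambda>z. cfun.dim (eigenspace z)"
  let ?m = "\<lambda>z. replicate_mset (?d z) (Re z)"
  obtain k where k: "?d (of_real \<sigma>) = Suc k"
    using eigenspace_dim_pos [OF \<sigma>_spec] gr0_conv_Suc by auto
  define M where "M = replicate_mset k \<sigma> + (\<Sum>z\<in>spectrum - {0} - {of_real \<sigma>}. ?m z)"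
  have "(\<Sum>z\<in>spectrum. ?m z) = ?m 0 + (\<Sum>z\<in>spectrum - {0}. ?m z)"
    using finite_spectrum zero_simple(1) by (rule sum.remove)
  also have "(\<Sum>z\<in>spectrum - {0}. ?m z)
      = ?m (of_real \<sigma>) + (\<Sum>z\<in>spectrum - {0} - {of_real \<sigma>}. ?m z)"
    using finite_spectrum \<sigma>_spec F(1) by (intro sum.remove) auto
  finally have M: "(\<Sum>z\<in>spectrum. ?m z) = add_mset 0 (add_mset \<sigma> M)"
    using zero_simple(2) k by (simp add: M_def)
  have M_ge: "\<sigma> \<le> r" if r: "r \<in># M" for r
  proof -
    consider "r = \<sigma>" | z where "z \<in> spectrum" "z \<noteq> 0" "r = Re z"
      using r finite_spectrum unfolding M_def
      by (auto simp: in_replicate_mset set_mset_sum split: if_splits)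
    then show ?thesis
      using spectrum_above_gap [OF F(5)] by cases auto
  qed
  have "steklov_eigenvalues V w \<mu> B = insort 0 (insort \<sigma> (sorted_list_of_multiset M))"
    unfolding steklov_eigenvalues_def M by simp
  also have "insort \<sigma> (sorted_list_of_multiset M) = \<sigma> # sorted_list_of_multiset M"
    using M_ge by (intro insort_is_Cons) auto
  also have "insort 0 (\<sigma> # sorted_list_of_multiset M) = 0 # \<sigma> # sorted_list_of_multiset M"
    using F(1) by simp
  finally have \<sigma>2: "steklov_sigma V w \<mu> B 2 = \<sigma>"
    by (simp add: steklov_sigma_def)
  show thesis
    by (rule that [of F]; (unfold \<sigma>2)?; rule gap)
qed

section \<open>Cuts\<close>

text \<open>In the multiplied form the bound persists for sets without \<open>m\<close>-mass, which lie outside the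
  infimum; the layers that appear in the coarea argument can be such sets.\<close>

lemma cheeger_times_mass_le_cut:
  assumes "A \<subseteq> V" "\<And>x. x \<in> V \<Longrightarrow> 0 \<le> m x" "sum \<nu> A \<le> sum \<nu> V / 2"
  shows "cheeger V w m \<nu> * sum m A \<le> cut_weight w A (V - A)"
proof (cases "0 < sum m A")
  case True
  have "finite {A. A \<subseteq> V \<and> 0 < sum m A \<and> sum \<nu> A \<le> sum \<nu> V / 2}"
    by (rule finite_subset [of _ "Pow V"]) auto
  then have "cheeger V w m \<nu> \<le> cut_weight w A (V - A) / sum m A"
    unfolding cheeger_def using assms True by (intro cINF_lower bdd_below_finite) auto
  then show ?thesis using True by (simp add: field_simps)
next
  case False
  moreover have "0 \<le> sum m A" using assms by (intro sum_nonneg) auto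
  ultimately have "sum m A = 0" by simp
  moreover have "0 \<le> cut_weight w A (V - A)"
    unfolding cut_weight_def using assms(1) by (intro sum_nonneg w_nonneg) auto
  ultimately show ?thesis by simp
qed

text \<open>The admissible set \<open>A\<close> in the first three assumptions shows that the infimum is not over the
  empty set.\<close>

lemma cheeger_greatest:
  assumes "A \<subseteq> V" "0 < sum m A" "sum \<nu> A \<le> sum \<nu> V / 2"
    and "\<And>A. A \<subseteq> V \<Longrightarrow> 0 < sum m A \<Longrightarrow> sum \<nu> A \<le> sum \<nu> V / 2 \<Longrightarrow>
      c \<le> cut_weight w A (V - A) / sum m A"
  shows "c \<le> cheeger V w m \<nu>"
  unfolding cheeger_def using assms by (intro cINF_greatest) auto

lemma cheeger_nonneg:
  assumes "A \<subseteq> V" "0 < sum m A" "sum \<nu> A \<le> sum \<nu> V / 2"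
  shows "0 \<le> cheeger V w m \<nu>"
proof (rule cheeger_greatest [OF assms])
  fix A assume "A \<subseteq> V" "0 < sum m A"
  then show "0 \<le> cut_weight w A (V - A) / sum m A"
    unfolding cut_weight_def by (intro divide_nonneg_pos sum_nonneg w_nonneg) auto
qed

definition total_variation :: "('a \<Rightarrow> real) \<Rightarrow> real" where
  "total_variation \<phi> = (\<Sum>x\<in>V. \<Sum>y\<in>V. w x y * \<bar>\<phi> x - \<phi> y\<bar>) / 2"

lemma total_variation_indicator:
  assumes A: "A \<subseteq> V"
  shows "total_variation (indicator A) = cut_weight w A (V - A)"
proof -
  let ?f = "\<lambda>x y. w x y * \<bar>indicator A x - indicator A y\<bar>"
  have "(\<Sum>x\<in>A. \<Sum>y\<in>V. ?f x y) = (\<Sum>x\<in>A. \<Sum>y\<in>V - A. w x y)"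
    by (intro sum.cong refl sum.mono_neutral_cong_right) auto
  moreover have "(\<Sum>x\<in>V - A. \<Sum>y\<in>V. ?f x y) = (\<Sum>x\<in>V - A. \<Sum>y\<in>A. w x y)"
    using A by (intro sum.cong refl sum.mono_neutral_cong_right) auto
  moreover have "(\<Sum>x\<in>V - A. \<Sum>y\<in>A. w x y) = (\<Sum>x\<in>A. \<Sum>y\<in>V - A. w x y)"
    using A by (subst sum.swap) (auto intro!: sum.cong w_sym)
  moreover have "(\<Sum>x\<in>V. \<Sum>y\<in>V. ?f x y)
      = (\<Sum>x\<in>V - A. \<Sum>y\<in>V. ?f x y) + (\<Sum>x\<in>A. \<Sum>y\<in>V. ?f x y)"
    using A by (intro sum.subset_diff) auto
  ultimately show ?thesis by (simp add: total_variation_def cut_weight_def)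
qed

lemma energy_indicator: "A \<subseteq> V \<Longrightarrow> energy (indicator A) = cut_weight w A (V - A)"
proof -
  have "(indicator A x - indicator A y :: real)\<^sup>2 = \<bar>indicator A x - indicator A y\<bar>" for x y
    by (simp add: indicator_def)
  then show "A \<subseteq> V \<Longrightarrow> ?thesis"
    by (simp add: total_variation_indicator [symmetric] total_variation_def energy_def)
qed

text \<open>The discrete coarea formula as an inequality. Instead of integrating over the level sets of
  \<open>\<phi>\<close>, its lowest layer, the least positive value times the indicator of the support, is removed.
  Both sides are additive under this, and the support shrinks.\<close>

lemma coarea:
  assumes "\<And>x. x \<in> V \<Longrightarrow> 0 \<le> \<phi> x"
    and "\<And>A. A \<subseteq> {x\<in>V. 0 < \<phi> x} \<Longrightarrow> h * sum m A \<le> cut_weight w A (V - A)"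
  shows "h * (\<Sum>x\<in>V. m x * \<phi> x) \<le> total_variation \<phi>"
  using assms
proof (induction "card {x\<in>V. 0 < \<phi> x}" arbitrary: \<phi> rule: less_induct)
  case less
  define S where "S = {x\<in>V. 0 < \<phi> x}"
  have S: "S \<subseteq> V" "finite S" by (auto simp: S_def)
  show ?case
  proof (cases "S = {}")
    case True
    then have "\<phi> x = 0" if "x \<in> V" for x using less.prems(1) [OF that] that by (force simp: S_def)
    then show ?thesis by (simp add: total_variation_def)
  next
    case False
    define c where "c = Min (\<phi> ` S)"
    have c_le: "c \<le> \<phi> x" if "x \<in> S" for x using S that by (simp add: c_def)
    have "c \<in> \<phi> ` S" unfolding c_def using S False by (intro Min_in) auto
    then obtain s where s: "s \<in> S" "\<phi> s = c" by auto
    then have c0: "0 < c" by (auto simp: S_def)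
    define \<psi> where "\<psi> x = \<phi> x - c * indicator S x" for x
    have out: "\<phi> x = 0" if "x \<in> V" "x \<notin> S" for x
      using less.prems(1) [OF that(1)] that by (force simp: S_def)
    have \<psi>0: "0 \<le> \<psi> x" if "x \<in> V" for x
      using c_le [of x] out [OF that] by (cases "x \<in> S") (auto simp: \<psi>_def)
    have sub: "{x\<in>V. 0 < \<psi> x} \<subseteq> S"
      using c0 by (auto simp: \<psi>_def S_def indicator_def split: if_splits)
    moreover have "s \<notin> {x\<in>V. 0 < \<psi> x}" using s by (simp add: \<psi>_def)
    ultimately have "{x\<in>V. 0 < \<psi> x} \<subset> S" using s by blast
    then have "card {x\<in>V. 0 < \<psi> x} < card S" using S by (intro psubset_card_mono)
    then have IH: "h * (\<Sum>x\<in>V. m x * \<psi> x) \<le> total_variation \<psi>"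
      using \<psi>0 sub less.prems(2) by (intro less.hyps) (auto simp: S_def)
    have "\<bar>\<phi> x - \<phi> y\<bar> = \<bar>\<psi> x - \<psi> y\<bar> + c * \<bar>indicator S x - indicator S y\<bar>"
      if "x \<in> V" "y \<in> V" for x y
      using c_le [of x] c_le [of y] out [of x] out [of y] that c0
      by (cases "x \<in> S"; cases "y \<in> S") (auto simp: \<psi>_def)
    then have tv: "total_variation \<phi> = total_variation \<psi> + c * total_variation (indicator S)"
      by (simp add: total_variation_def distrib_left sum.distrib sum_distrib_left add_divide_distrib
          mult.left_commute cong: sum.cong)
    have "(\<Sum>x\<in>V. m x * \<phi> x) = (\<Sum>x\<in>V. m x * \<psi> x + c * (m x * indicator S x))"
      by (intro sum.cong refl) (simp add: \<psi>_def algebra_simps)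
    also have "\<dots> = (\<Sum>x\<in>V. m x * \<psi> x) + c * (\<Sum>x\<in>V. m x * indicator S x)"
      by (simp only: sum.distrib sum_distrib_left)
    also have "(\<Sum>x\<in>V. m x * indicator S x) = sum m S"
      using S by (intro sum.mono_neutral_cong_right) auto
    finally have "h * (\<Sum>x\<in>V. m x * \<phi> x) = h * (\<Sum>x\<in>V. m x * \<psi> x) + c * (h * sum m S)"
      by (simp add: algebra_simps)
    also have "c * (h * sum m S) \<le> c * total_variation (indicator S)"
      using less.prems(2) [of S] c0 S by (simp add: total_variation_indicator S_def)
    finally show ?thesis using IH tv by simp
  qed
qed

lemma wdeg_eq: "x \<in> V \<Longrightarrow> wdeg V w x = (\<Sum>y\<in>V. w x y)"
  unfolding wdeg_def by (rule sum.mono_neutral_left) (auto simp: w_diag)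

lemma wdeg_nonneg: "x \<in> V \<Longrightarrow> 0 \<le> wdeg V w x"
  by (simp add: wdeg_eq sum_nonneg w_nonneg)

lemma wdeg_pos:
  assumes x: "x \<in> V"
  shows "0 < wdeg V w x"
proof -
  obtain a b where "a \<in> V" "b \<in> V" "a \<noteq> b" using two_in_B B_sub by (metis subsetD)
  then obtain y where y: "y \<in> V" "y \<noteq> x" by metis
  then have "(x, y) \<in> (edges V w)\<^sup>*" using x conn by (auto simp: connected_graph_def)
  then obtain z where "(x, z) \<in> edges V w" using y(2) by (metis converse_rtranclE)
  then show ?thesis
    unfolding wdeg_eq [OF x] by (intro sum_pos2 [of V z]) (auto simp: edges_def w_nonneg)
qed

text \<open>Cauchy-Schwarz applied to \<open>\<bar>g x - g y\<bar>\<close> and \<open>\<bar>g x + g y\<bar>\<close>, whose product is \<open>\<bar>(g x)\<^sup>2 - (g y)\<^sup>2\<bar>\<close>.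
  The factor with the sum is controlled by \<open>(g x + g y)\<^sup>2 \<le> 2 (g x)\<^sup>2 + 2 (g y)\<^sup>2\<close>; this is where the
  degree comes in.\<close>

lemma total_variation_square_le:
  "(total_variation (\<lambda>x. (g x)\<^sup>2))\<^sup>2 \<le> 2 * energy g * (\<Sum>x\<in>V. wdeg V w x * (g x)\<^sup>2)"
proof -
  let ?D = "\<Sum>x\<in>V. wdeg V w x * (g x)\<^sup>2"
  let ?a = "\<lambda>(x, y). sqrt (w x y) * \<bar>g x - g y\<bar>"
  let ?b = "\<lambda>(x, y). sqrt (w x y) * \<bar>g x + g y\<bar>"
  have w: "\<bar>w x y\<bar> = w x y" if "x \<in> V" "y \<in> V" for x y
    using w_nonneg [OF that] by simp
  have factor: "w x y * \<bar>(g x)\<^sup>2 - (g y)\<^sup>2\<bar> = ?a (x, y) * ?b (x, y)" if "x \<in> V" "y \<in> V" for x y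
  proof -
    have "(g x)\<^sup>2 - (g y)\<^sup>2 = (g x - g y) * (g x + g y)"
      by (simp add: power2_eq_square algebra_simps)
    then have "w x y * \<bar>(g x)\<^sup>2 - (g y)\<^sup>2\<bar>
        = (sqrt (w x y) * sqrt (w x y)) * (\<bar>g x - g y\<bar> * \<bar>g x + g y\<bar>)"
      using w_nonneg [OF that] by (simp add: abs_mult)
    then show ?thesis by (simp only: mult_ac prod.case)
  qed
  have "2 * total_variation (\<lambda>x. (g x)\<^sup>2) = (\<Sum>(x, y)\<in>V \<times> V. w x y * \<bar>(g x)\<^sup>2 - (g y)\<^sup>2\<bar>)"
    by (simp add: total_variation_def sum.cartesian_product)
  also have "\<dots> = (\<Sum>p\<in>V \<times> V. ?a p * ?b p)"
    by (intro sum.cong refl) (use factor in force)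
  finally have "2 * total_variation (\<lambda>x. (g x)\<^sup>2) = (\<Sum>p\<in>V \<times> V. ?a p * ?b p)" .
  moreover have a2: "(\<Sum>p\<in>V \<times> V. (?a p)\<^sup>2) = 2 * energy g"
    unfolding sum.cartesian_product energy_def
    by (auto intro!: sum.cong simp: w power_mult_distrib w_nonneg)
  moreover have "(\<Sum>p\<in>V \<times> V. (?b p)\<^sup>2) \<le> 4 * ?D"
  proof -
    have 1: "(\<Sum>x\<in>V. \<Sum>y\<in>V. w x y * (g x)\<^sup>2) = ?D"
      by (simp add: wdeg_eq sum_distrib_right)
    have 2: "(\<Sum>x\<in>V. \<Sum>y\<in>V. w x y * (g y)\<^sup>2) = ?D"
      unfolding 1 [symmetric] by (subst sum.swap) (auto intro!: sum.cong simp: w_sym)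
    have "(\<Sum>p\<in>V \<times> V. (?b p)\<^sup>2) = (\<Sum>x\<in>V. \<Sum>y\<in>V. w x y * (g x + g y)\<^sup>2)"
      unfolding sum.cartesian_product by (auto intro!: sum.cong simp: w power_mult_distrib w_nonneg)
    also have "\<dots> \<le> (\<Sum>x\<in>V. \<Sum>y\<in>V. w x y * (2 * (g x)\<^sup>2 + 2 * (g y)\<^sup>2))"
    proof (intro sum_mono mult_left_mono w_nonneg)
      fix x y
      have "0 \<le> (g x - g y)\<^sup>2" by simp
      then show "(g x + g y)\<^sup>2 \<le> 2 * (g x)\<^sup>2 + 2 * (g y)\<^sup>2"
        by (simp add: power2_eq_square algebra_simps)
    qed
    also have "\<dots> = 2 * (\<Sum>x\<in>V. \<Sum>y\<in>V. w x y * (g x)\<^sup>2) + 2 * (\<Sum>x\<in>V. \<Sum>y\<in>V. w x y * (g y)\<^sup>2)"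
      by (simp add: distrib_left sum.distrib sum_distrib_left mult.left_commute)
    finally show ?thesis using 1 2 by simp
  qed
  ultimately have "(2 * total_variation (\<lambda>x. (g x)\<^sup>2))\<^sup>2 \<le> 2 * energy g * (4 * ?D)"
    using Cauchy_Schwarz_ineq_sum [of ?a ?b "V \<times> V"] energy_nonneg [of g]
    by (smt (verit) mult_left_mono)
  then show ?thesis by (simp add: power_mult_distrib)
qed

section \<open>The two Cheeger bounds\<close>

text \<open>Truncation can only lower the flux at the points where \<open>F\<close> is positive.\<close>

lemma energy_positive_part_le:
  fixes F :: "'a \<Rightarrow> real"
  assumes eq: "\<And>x. x \<in> V \<Longrightarrow> flux F x = \<sigma> * mB x * F x"
  shows "energy (\<lambda>x. max 0 (F x)) \<le> \<sigma> * (\<Sum>x\<in>V. mB x * (max 0 (F x))\<^sup>2)"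
  unfolding energy_eq sum_distrib_left
proof (rule sum_mono)
  fix x assume x: "x \<in> V"
  let ?g = "\<lambda>x. max 0 (F x)"
  show "flux ?g x * ?g x \<le> \<sigma> * (mB x * (?g x)\<^sup>2)"
  proof (cases "0 < F x")
    case True
    have "flux ?g x \<le> flux F x"
      unfolding flux_def using True x by (intro sum_mono) (auto intro!: mult_left_mono w_nonneg)
    then have "flux ?g x * F x \<le> flux F x * F x" using True by (intro mult_right_mono) auto
    then show ?thesis using True eq [OF x] by (simp add: power2_eq_square mult.assoc)
  qed auto
qed

text \<open>The positive part \<open>g\<close> of the eigenfunction lives on a set of at most half of the \<open>\<nu>\<close>-mass, so
  all level sets of \<open>g\<^sup>2\<close> compete in both Cheeger constants. The total variation of \<open>g\<^sup>2\<close> is bounded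
  below twice by the coarea inequality, once for each of the measures \<open>mB\<close> and \<open>wdeg V w\<close>, and the
  product of the two bounds meets Cauchy-Schwarz from above. The mass \<open>?M\<close> cancels against the energy
  estimate and \<open>?D\<close> against the Cauchy-Schwarz factor.\<close>

lemma cheeger_lower_bound:
  fixes F :: "'a \<Rightarrow> real"
  assumes eq: "\<And>x. x \<in> V \<Longrightarrow> flux F x = \<sigma> * mB x * F x" and a: "a \<in> B" "0 < F a"
    and \<nu>: "nonneg_on V \<nu>" and half: "sum \<nu> {x\<in>V. 0 < F x} \<le> sum \<nu> V / 2"
  shows "1 / 2 * cheeger V w mB \<nu> * cheeger V w (wdeg V w) \<nu> \<le> \<sigma>"
proof -
  have combine: "h1 * h2 \<le> 2 * \<sigma>"
    if 1: "h1 * M \<le> C" and 2: "h2 * D \<le> C" and 3: "C\<^sup>2 \<le> 2 * E * D" and 4: "E \<le> \<sigma> * M"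
      and 0: "0 \<le> h1" "0 \<le> h2" "0 < M" "0 < D" for h1 h2 M D C E :: real
  proof -
    have nn: "0 \<le> h1 * M" "0 \<le> h2 * D" using 0 by simp_all
    have "(h1 * M) * (h2 * D) \<le> C * C"
      by (rule mult_mono [OF 1 2 order_trans [OF nn(1) 1] nn(2)])
    also have "\<dots> \<le> 2 * E * D" using 3 by (simp add: power2_eq_square)
    also have "\<dots> \<le> 2 * (\<sigma> * M) * D" using 4 0 by (intro mult_right_mono mult_left_mono) auto
    finally have "(h1 * h2) * (M * D) \<le> (2 * \<sigma>) * (M * D)" by (simp add: mult_ac)
    moreover have "0 < M * D" using 0 by simp
    ultimately show ?thesis by (rule mult_right_le_imp_le)
  qed
  define g where "g x = max 0 (F x)" for x
  let ?S = "{x\<in>V. 0 < F x}"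
  let ?h1 = "cheeger V w mB \<nu>" and ?h2 = "cheeger V w (wdeg V w) \<nu>"
  let ?M = "\<Sum>x\<in>V. mB x * (g x)\<^sup>2" and ?D = "\<Sum>x\<in>V. wdeg V w x * (g x)\<^sup>2"
  let ?C = "total_variation (\<lambda>x. (g x)\<^sup>2)"
  have aV: "a \<in> V" using a B_sub by auto
  have ga: "0 < g a" using a by (simp add: g_def)
  have M: "0 < ?M" using a ga sum_mB_square_pos [of a g] by simp
  have D: "0 < ?D"
    using aV ga by (intro sum_pos2 [of V a]) (auto simp: wdeg_pos wdeg_nonneg)
  have small: "sum \<nu> A \<le> sum \<nu> V / 2" if "A \<subseteq> ?S" for A
  proof -
    have "sum \<nu> A \<le> sum \<nu> ?S"
      using that \<nu> by (intro sum_mono2) (auto simp: nonneg_on_def)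
    then show ?thesis using half by linarith
  qed
  have supp: "{x\<in>V. 0 < (g x)\<^sup>2} = ?S" by (auto simp: g_def)
  have h1M: "?h1 * ?M \<le> ?C"
  proof (rule coarea)
    fix A assume "A \<subseteq> {x\<in>V. 0 < (g x)\<^sup>2}"
    then have "A \<subseteq> ?S" unfolding supp .
    then show "?h1 * sum mB A \<le> cut_weight w A (V - A)"
      by (intro cheeger_times_mass_le_cut small mB_nonneg) auto
  qed simp
  have h2D: "?h2 * ?D \<le> ?C"
  proof (rule coarea)
    fix A assume "A \<subseteq> {x\<in>V. 0 < (g x)\<^sup>2}"
    then have "A \<subseteq> ?S" unfolding supp .
    then show "?h2 * sum (wdeg V w) A \<le> cut_weight w A (V - A)"
      by (intro cheeger_times_mass_le_cut small wdeg_nonneg) auto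
  qed simp
  have h1: "0 \<le> ?h1"
    using a aV half by (intro cheeger_nonneg [of ?S] sum_pos2 [of ?S a]) (auto simp: mB_pos mB_nonneg)
  have h2: "0 \<le> ?h2"
    using a aV half by (intro cheeger_nonneg [of ?S] sum_pos2 [of ?S a]) (auto simp: wdeg_pos wdeg_nonneg)
  have E: "energy g \<le> \<sigma> * ?M"
    using energy_positive_part_le [OF eq] unfolding g_def .
  have "?h1 * ?h2 \<le> 2 * \<sigma>"
    by (rule combine [OF h1M h2D total_variation_square_le E h1 h2 M D])
  then show ?thesis by simp
qed

lemma centred_takes_positive_value:
  fixes F :: "'a \<Rightarrow> real"
  assumes "(\<Sum>x\<in>V. mB x * F x) = 0" "a \<in> B" "F a \<noteq> 0"
  shows "\<exists>b\<in>B. 0 < F b"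
proof (rule ccontr)
  assume "\<not> ?thesis"
  then have neg: "F x \<le> 0" if "x \<in> B" for x using that by force
  have "0 < (\<Sum>x\<in>B. mB x * (- F x))"
  proof (rule sum_pos2 [of B a])
    have "F a < 0" using neg [OF assms(2)] assms(3) by simp
    then show "0 < mB a * (- F a)" using mB_pos [OF assms(2)] by (intro mult_pos_pos) auto
    show "0 \<le> mB x * (- F x)" if "x \<in> B" for x
      using neg [OF that] mB_pos [OF that] by (intro mult_nonneg_nonneg) auto
  qed (use assms in auto)
  then show False using assms(1) sum_mB [of F] by (simp add: sum_negf)
qed

text \<open>The eigenfunction is centred and so takes both signs on \<open>B\<close>. The sets where it is positive and
  where it is negative are disjoint, so one of them has at most half of the \<open>\<nu>\<close>-mass.\<close>

theorem steklov_cheeger_lower: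
  assumes \<nu>: "nonneg_on V \<nu>"
  shows "1 / 2 * cheeger V w mB \<nu> * cheeger V w (wdeg V w) \<nu> \<le> steklov_sigma V w \<mu> B 2"
proof -
  let ?\<sigma> = "steklov_sigma V w \<mu> B 2"
  obtain F where "0 < ?\<sigma>" "\<forall>x\<in>V. flux F x = ?\<sigma> * mB x * F x" "\<exists>x\<in>B. F x \<noteq> 0"
    by (rule sigma_two)
  note F = this(1) this(2) [rule_format] this(3)
  let ?N = "\<lambda>x. - F x"
  have N: "flux ?N x = ?\<sigma> * mB x * ?N x" if "x \<in> V" for x
    using F(2) [OF that] flux_diff [of "\<lambda>_. 0" F x] by (simp add: flux_def)
  have "(\<Sum>x\<in>V. mB x * F x) = 0"
    using real_eigenfunction_energy(2) [OF F(2)] F(1) by simp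
  then have "\<exists>b\<in>B. 0 < F b" "\<exists>b\<in>B. 0 < ?N b"
    using F(3) centred_takes_positive_value [of F] centred_takes_positive_value [of ?N]
    by (auto simp: sum_negf)
  then obtain a b where ab: "a \<in> B" "0 < F a" "b \<in> B" "0 < ?N b" by blast
  have "sum \<nu> {x\<in>V. 0 < F x} + sum \<nu> {x\<in>V. 0 < ?N x} = sum \<nu> ({x\<in>V. 0 < F x} \<union> {x\<in>V. 0 < ?N x})"
    by (intro sum.union_disjoint [symmetric]) auto
  also have "\<dots> \<le> sum \<nu> V"
    using \<nu> by (intro sum_mono2) (auto simp: nonneg_on_def)
  finally consider "sum \<nu> {x\<in>V. 0 < F x} \<le> sum \<nu> V / 2" | "sum \<nu> {x\<in>V. 0 < ?N x} \<le> sum \<nu> V / 2"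
    by linarith
  then show ?thesis
  proof cases
    case 1
    then show ?thesis using cheeger_lower_bound [OF F(2) ab(1,2) \<nu>] by blast
  next
    case 2
    then show ?thesis using cheeger_lower_bound [OF N ab(3,4) \<nu>] by blast
  qed
qed

text \<open>The indicator of \<open>A\<close> is the test function: its energy is the cut and, when \<open>A\<close> has at most half of
  the mass of \<open>B\<close>, its variance is at least half of the mass of \<open>A\<close>.\<close>

theorem steklov_cheeger_upper: "steklov_sigma V w \<mu> B 2 \<le> 2 * cheeger V w mB mB"
proof -
  let ?\<sigma> = "steklov_sigma V w \<mu> B 2"
  have \<sigma>: "0 < ?\<sigma>" and gap: "\<forall>G. ?\<sigma> * variance G \<le> energy G"
    by (rule sigma_two, assumption)+
  obtain a b where ab: "a \<in> B" "b \<in> B" "a \<noteq> b" by (rule two_in_B)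
  have "sum mB {a, b} \<le> sum mB V"
    using ab B_sub by (intro sum_mono2) (auto simp: mB_nonneg)
  then have "mB a \<le> sum mB V / 2 \<or> mB b \<le> sum mB V / 2" using ab by auto
  then obtain c where c: "c \<in> B" "mB c \<le> sum mB V / 2" using ab by blast
  have "?\<sigma> / 2 \<le> cheeger V w mB mB"
  proof (rule cheeger_greatest [of "{c}"])
    fix A assume A: "A \<subseteq> V" "0 < sum mB A" "sum mB A \<le> sum mB V / 2"
    have "(\<Sum>x\<in>V. mB x * indicator A x) = sum mB A"
      using A by (intro sum.mono_neutral_cong_right) auto
    moreover have "(\<Sum>x\<in>V. mB x * (indicator A x)\<^sup>2) = sum mB A"
      using A by (intro sum.mono_neutral_cong_right) auto
    ultimately have "variance (indicator A) = sum mB A - (sum mB A)\<^sup>2 / sum mB V"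
      by (simp add: variance_def)
    also have "\<dots> \<ge> sum mB A / 2"
    proof -
      have "sum mB A * sum mB A \<le> sum mB A * (sum mB V / 2)"
        using A by (intro mult_left_mono) auto
      then show ?thesis using sum_mB_pos by (simp add: field_simps power2_eq_square)
    qed
    finally have "?\<sigma> * (sum mB A / 2) \<le> ?\<sigma> * variance (indicator A)"
      using \<sigma> by (intro mult_left_mono) auto
    also have "\<dots> \<le> cut_weight w A (V - A)"
      using gap [rule_format, of "indicator A"] energy_indicator [OF A(1)] by simp
    finally show "?\<sigma> / 2 \<le> cut_weight w A (V - A) / sum mB A"
      using A(2) by (simp add: field_simps)
  qed (use c B_sub mB_pos in auto)
  then show ?thesis by simp
qed

end

theorem theorem1p3:
  fixes V B :: "'a set"
    and w :: "'a \<Rightarrow> 'a \<Rightarrow> real"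
    and \<mu> \<mu>\<^sub>B \<nu> :: "'a \<Rightarrow> real"
  assumes "weighted_graph V w \<mu>"
    and "connected_graph V w"
    and "B \<subseteq> V" and "2 \<le> card B"
    and "\<mu>\<^sub>B = (\<lambda>x. indicator B x * \<mu> x)"
    and "nonneg_on V \<nu>"
  shows "2 * cheeger V w \<mu>\<^sub>B \<mu>\<^sub>B \<ge> steklov_sigma V w \<mu> B 2
       \<and> steklov_sigma V w \<mu> B 2 \<ge> 1 / 2 * cheeger V w \<mu>\<^sub>B \<nu> * cheeger V w (wdeg V w) \<nu>"
proof -
  interpret steklov_graph V B w \<mu>
    using assms by unfold_locales
  have "\<mu>\<^sub>B = mB"
    using assms(5) by (simp add: mB_def fun_eq_iff)
  then show ?thesis
    using steklov_cheeger_upper steklov_cheeger_lower [OF assms(6)] by simp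
qed

end
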